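(* A connected lattice path matroid $M[P,Q]$ on at least two elements has a spanning circuit.
   Context: Lattice paths start at $(0,0)$ and use steps $E=(1,0)$ and $N=(0,1)$. For lattice paths $P,Q$ from $(0,0)$ to $(m,r)$ with $P$ never going above $Q$, let $\mathcal{P}$ be the set of lattice paths from $(0,0)$ to $(m,r)$ going neither above $Q$ nor below $P$, and for $1\le i\le r$ let $N_i=\{j:\text{step } j \text{ is the } i\text{-th North step of some path in }\mathcal{P}\}$. $M[P,Q]$ is the transversal matroid on $[m+r]$ with presentation $(N_1,\ldots,N_r)$. A spanning circuit is a circuit whose closure is the whole ground set. *)

theory Defs
  imports Main
begin

section \<open>Matroid notions\<close>

text \<open>
  A matroid on a finite ground set is given by its independent sets. The record carries only the
  data; the notions below are the textbook ones and are meant for records satisfying the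
  independence axioms with a finite ground set, such as transversal matroids.
\<close>

record 'a matroid =
  ground :: "'a set"
  indep :: "'a set set"

definition circuit :: "'a matroid \<Rightarrow> 'a set \<Rightarrow> bool" where
  "circuit M C \<longleftrightarrow> C \<subseteq> ground M \<and> C \<notin> indep M \<and> (\<forall>D. D \<subset> C \<longrightarrow> D \<in> indep M)"

definition mrank :: "'a matroid \<Rightarrow> 'a set \<Rightarrow> nat" where
  "mrank M X = Max (card ` {I. I \<in> indep M \<and> I \<subseteq> X})"

definition mclosure :: "'a matroid \<Rightarrow> 'a set \<Rightarrow> 'a set" where
  "mclosure M X = {x \<in> ground M. mrank M (insert x X) = mrank M X}"

definition spanning_circuit :: "'a matroid \<Rightarrow> 'a set \<Rightarrow> bool" where
  "spanning_circuit M C \<longleftrightarrow> circuit M C \<and> mclosure M C = ground M"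

definition connected_matroid :: "'a matroid \<Rightarrow> bool" where
  "connected_matroid M \<longleftrightarrow>
     (\<forall>x \<in> ground M. \<forall>y \<in> ground M. x \<noteq> y \<longrightarrow> (\<exists>C. circuit M C \<and> x \<in> C \<and> y \<in> C))"

definition partial_transversal :: "'i set \<Rightarrow> ('i \<Rightarrow> 'a set) \<Rightarrow> 'a set \<Rightarrow> bool" where
  "partial_transversal I A X \<longleftrightarrow> (\<exists>J \<subseteq> I. \<exists>f. bij_betw f J X \<and> (\<forall>j \<in> J. f j \<in> A j))"

definition transversal_matroid :: "'a set \<Rightarrow> 'i set \<Rightarrow> ('i \<Rightarrow> 'a set) \<Rightarrow> 'a matroid" where
  "transversal_matroid S I A =
     \<lparr>ground = S, indep = {X. X \<subseteq> S \<and> partial_transversal I A X}\<rparr>"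

section \<open>Lattice paths\<close>

datatype step = East | North

text \<open>
  A lattice path starting at the origin is its list of steps. Steps are numbered from 1, so
  step \<open>j\<close> of \<open>R\<close> is \<open>R ! (j - 1)\<close>.
\<close>

definition lattice_paths :: "nat \<Rightarrow> nat \<Rightarrow> step list set" where
  "lattice_paths m r = {R. count_list R East = m \<and> count_list R North = r}"

definition height :: "step list \<Rightarrow> nat \<Rightarrow> nat" where
  "height R j = count_list (take j R) North"

text \<open>
  For two paths with the same endpoints: after \<open>j\<close> steps both are on the antidiagonal
  \<open>x + y = j\<close>, and \<open>R\<close> is above \<open>Q\<close> there iff it has the larger \<open>y\<close>-coordinate. Accordingly,
  \<open>R\<close> never goes below \<open>P\<close> iff \<open>never_above P R\<close>.
\<close>

definition never_above :: "step list \<Rightarrow> step list \<Rightarrow> bool" where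
  "never_above R Q \<longleftrightarrow> (\<forall>j. height R j \<le> height Q j)"

definition paths_between :: "nat \<Rightarrow> nat \<Rightarrow> step list \<Rightarrow> step list \<Rightarrow> step list set" where
  "paths_between m r P Q = {R \<in> lattice_paths m r. never_above R Q \<and> never_above P R}"

definition ith_north_step :: "step list \<Rightarrow> nat \<Rightarrow> nat \<Rightarrow> bool" where
  "ith_north_step R i j \<longleftrightarrow>
     1 \<le> j \<and> j \<le> length R \<and> R ! (j - 1) = North \<and> height R j = i"

definition north_sets :: "nat \<Rightarrow> nat \<Rightarrow> step list \<Rightarrow> step list \<Rightarrow> nat \<Rightarrow> nat set" where
  "north_sets m r P Q i = {j. \<exists>R \<in> paths_between m r P Q. ith_north_step R i j}"

definition lattice_path_matroid :: "nat \<Rightarrow> nat \<Rightarrow> step list \<Rightarrow> step list \<Rightarrow> nat matroid" where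
  "lattice_path_matroid m r P Q =
     transversal_matroid {1..m + r} {1..r} (north_sets m r P Q)"

end

theory Submission
  imports Defs
begin

text \<open>
  If \<open>P\<close> and \<open>Q\<close> meet after \<open>k\<close> steps with \<open>0 < k < m + r\<close>, then all paths between them pass
  through the meeting point, so the matroid splits as a direct sum over \<open>{1..k}\<close> and \<open>{k<..m + r}\<close>,
  and no circuit contains both \<open>k\<close> and \<open>k + 1\<close>. Hence connectedness forces \<open>P\<close> to be strictly below
  \<open>Q\<close> except at the endpoints. Then the North steps of \<open>Q\<close> together with the last step \<open>m + r\<close> form
  a spanning circuit: turning some North step of \<open>Q\<close> into an East step and the last step into a
  North step lowers \<open>Q\<close> by at most one, so gives another path between \<open>P\<close> and \<open>Q\<close>, and the North
  steps of such a path are a basis.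
\<close>

section \<open>Partial transversals and rank\<close>

lemma partial_transversal_subset:
  assumes "partial_transversal I A X" and "Y \<subseteq> X"
  shows "partial_transversal I A Y"
proof -
  obtain J f where J: "J \<subseteq> I" and f: "bij_betw f J X" and A: "\<forall>j\<in>J. f j \<in> A j"
    using assms(1) unfolding partial_transversal_def by blast
  have "bij_betw f {j \<in> J. f j \<in> Y} Y"
    using f assms(2) unfolding bij_betw_def inj_on_def by blast
  then show ?thesis
    unfolding partial_transversal_def using J A
    by (intro exI[of _ "{j \<in> J. f j \<in> Y}"]) auto
qed

lemma partial_transversal_card_le:
  assumes "partial_transversal I A X" and "finite I"
  shows "card X \<le> card I"
  using assms unfolding partial_transversal_def by (metis bij_betw_same_card card_mono)

text \<open>Matchings with disjoint index sets and disjoint images glue to one matching.\<close>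

lemma partial_transversal_Un:
  assumes "partial_transversal I A X" and "partial_transversal K A Y"
    and "I \<inter> K = {}" and "X \<inter> Y = {}"
  shows "partial_transversal (I \<union> K) A (X \<union> Y)"
proof -
  obtain J f where J: "J \<subseteq> I" and f: "bij_betw f J X" and fA: "\<forall>j\<in>J. f j \<in> A j"
    using assms(1) unfolding partial_transversal_def by blast
  obtain L g where L: "L \<subseteq> K" and g: "bij_betw g L Y" and gA: "\<forall>j\<in>L. g j \<in> A j"
    using assms(2) unfolding partial_transversal_def by blast
  let ?h = "\<lambda>j. if j \<in> J then f j else g j"
  have disj: "J \<inter> L = {}" using J L assms(3) by blast
  have "bij_betw ?h J X"
    using f by (simp cong: bij_betw_cong)
  moreover have "bij_betw ?h L Y"
    using g disj by (subst bij_betw_cong[of _ _ g]) auto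
  ultimately have "bij_betw ?h (J \<union> L) (X \<union> Y)"
    using assms(4) by (rule bij_betw_combine)
  then show ?thesis
    unfolding partial_transversal_def using J L fA gA
    by (intro exI[of _ "J \<union> L"] conjI exI[of _ ?h]) auto
qed

text \<open>An index outside \<open>K\<close> has no element of \<open>X\<close> available, so a
  matching onto \<open>X\<close> never uses it.\<close>

lemma partial_transversal_restrict_index:
  assumes "partial_transversal I A X" and "\<And>i. i \<in> I - K \<Longrightarrow> A i \<inter> X = {}"
  shows "partial_transversal (I \<inter> K) A X"
proof -
  obtain J f where J: "J \<subseteq> I" and f: "bij_betw f J X" and A: "\<forall>j\<in>J. f j \<in> A j"
    using assms(1) unfolding partial_transversal_def by blast
  have "J \<subseteq> I \<inter> K"
    using J A assms(2) bij_betwE[OF f] by blast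
  then show ?thesis
    unfolding partial_transversal_def using f A by blast
qed

lemma mrank_eqI:
  assumes "I \<in> indep M" and "I \<subseteq> X" and "card I = k"
    and "\<And>J. J \<in> indep M \<Longrightarrow> card J \<le> k"
  shows "mrank M X = k"
proof -
  have "finite (card ` {I. I \<in> indep M \<and> I \<subseteq> X})"
    by (rule finite_subset[of _ "{..k}"]) (use assms(4) in auto)
  then show ?thesis
    unfolding mrank_def using assms by (intro Max_eqI) auto
qed

section \<open>Heights along lattice paths\<close>

lemma height_0 [simp]: "height R 0 = 0"
  by (simp add: height_def)

lemma height_Suc:
  "height R (Suc j) = height R j + (if j < length R \<and> R ! j = North then 1 else 0)"
  by (cases "j < length R") (simp_all add: height_def take_Suc_conv_app_nth)

lemma height_mono: "j \<le> k \<Longrightarrow> height R j \<le> height R k"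
  by (rule lift_Suc_mono_le) (simp_all add: height_Suc)

lemma height_ge_length: "length R \<le> j \<Longrightarrow> height R j = height R (length R)"
  by (simp add: height_def)

lemma height_less_North:
  assumes "i < j" and "j \<le> length R" and "R ! (j - 1) = North"
  shows "height R i < height R j"
proof -
  obtain l where "j = Suc l" using assms(1) by (cases j) auto
  then show ?thesis
    using assms height_mono[of i l R] by (simp add: height_Suc)
qed

lemma count_list_update_East:
  "p < length R \<Longrightarrow> R ! p = North \<Longrightarrow> Suc (count_list (R[p := East]) North) = count_list R North"
  by (induction R arbitrary: p) (auto simp: nth_Cons split: nat.splits)

text \<open>The lost North step is added back on the right, which avoids truncated
  subtraction.\<close>

lemma height_update_East:
  assumes "p < length R" and "R ! p = North"
  shows "height R j = height (R[p := East]) j + (if p < j then 1 else 0)"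
proof (cases "p < j")
  case True
  then show ?thesis
    using assms count_list_update_East[of p "take j R"]
    by (simp add: height_def take_update_swap)
next
  case False
  then show ?thesis by (simp add: height_def)
qed

lemma height_update_North:
  assumes "p < length R" and "R ! p = East"
  shows "height (R[p := North]) j = height R j + (if p < j then 1 else 0)"
  \<comment> \<open>Setting position \<open>p\<close> of \<open>R[p := North]\<close> back to
    \<open>East\<close> restores \<open>R\<close>.\<close>
  using height_update_East[of p "R[p := North]" j] assms
    list_update_id[of R p]
  by simp

lemma lattice_paths_iff:
  "R \<in> lattice_paths m r \<longleftrightarrow> length R = m + r \<and> height R (m + r) = r"
proof -
  have "count_list R East + count_list R North = length R"
  proof (induction R)
    case (Cons s R)
    then show ?case by (cases s) auto
  qed simp
  then show ?thesis
    by (auto simp: lattice_paths_def height_def)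
qed

lemma height_lattice_path_ge:
  "R \<in> lattice_paths m r \<Longrightarrow> m + r \<le> j \<Longrightarrow> height R j = r"
  using height_ge_length[of R j] by (auto simp: lattice_paths_iff)

lemma height_lattice_path_le: "R \<in> lattice_paths m r \<Longrightarrow> height R j \<le> r"
  by (metis height_lattice_path_ge height_mono nle_le)

text \<open>Numbered from 1 to match the ground set \<open>{1..m + r}\<close>.\<close>

definition north_steps :: "step list \<Rightarrow> nat set" where
  "north_steps R = {j \<in> {1..length R}. R ! (j - 1) = North}"

lemma inj_on_height_north_steps: "inj_on (height R) (north_steps R)"
proof (rule linorder_inj_onI)
  fix i j assume "i < j" "i \<in> north_steps R" "j \<in> north_steps R"
  then show "height R i \<noteq> height R j"
    using height_less_North[of i j R] by (auto simp: north_steps_def)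
qed auto

lemma card_north_steps: "card (north_steps R) = height R (length R)"
proof -
  have "north_steps R = Suc ` {i. i < length R \<and> R ! i = North}"
  proof (rule set_eqI)
    fix j
    show "j \<in> north_steps R \<longleftrightarrow> j \<in> Suc ` {i. i < length R \<and> R ! i = North}"
      by (cases j) (simp_all add: north_steps_def image_iff Suc_le_eq)
  qed
  then show ?thesis
    by (simp add: height_def count_list_eq_length_filter length_filter_conv_card card_image
        eq_commute[of North])
qed

section \<open>Independent sets and circuits of lattice path matroids\<close>

lemma ground_lattice_path_matroid [simp]: "ground (lattice_path_matroid m r P Q) = {1..m + r}"
  by (simp add: lattice_path_matroid_def transversal_matroid_def)

lemma indep_lattice_path_matroid:
  "X \<in> indep (lattice_path_matroid m r P Q) \<longleftrightarrow>
     X \<subseteq> {1..m + r} \<and> partial_transversal {1..r} (north_sets m r P Q) X"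
  by (simp add: lattice_path_matroid_def transversal_matroid_def)

text \<open>Matching each \<open>i\<close> with the \<open>i\<close>-th North step of
  \<open>R\<close> uses all \<open>r\<close> sets of the presentation, by the very definition of
  these sets.\<close>

lemma indep_north_steps:
  assumes "R \<in> paths_between m r P Q"
  shows "north_steps R \<in> indep (lattice_path_matroid m r P Q)" and "card (north_steps R) = r"
proof -
  have R: "R \<in> lattice_paths m r" and len: "length R = m + r"
    using assms by (auto simp: paths_between_def lattice_paths_iff)
  show card: "card (north_steps R) = r"
    using R by (simp add: card_north_steps lattice_paths_iff)
  have "height R j \<in> {1..r}" if "j \<in> north_steps R" for j
    using height_less_North[of 0 j R] height_lattice_path_le[OF R] that
    by (simp add: north_steps_def)
  then have "height R ` north_steps R \<subseteq> {1..r}" by blast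
  \<comment> \<open>An injective image of \<open>r\<close> elements inside \<open>{1..r}\<close> is
    all of it.\<close>
  then have "height R ` north_steps R = {1..r}"
    by (intro card_subset_eq) (simp_all add: card_image inj_on_height_north_steps card)
  then have bij: "bij_betw (height R) (north_steps R) {1..r}"
    by (simp add: bij_betw_def inj_on_height_north_steps)
  let ?f = "the_inv_into (north_steps R) (height R)"
  have "?f j \<in> north_sets m r P Q j" if "j \<in> {1..r}" for j
  proof -
    have "?f j \<in> north_steps R" "height R (?f j) = j"
      using that bij by (auto simp: bij_betw_def the_inv_into_into f_the_inv_into_f)
    then show ?thesis
      using assms by (auto simp: north_sets_def ith_north_step_def north_steps_def)
  qed
  then have "partial_transversal {1..r} (north_sets m r P Q) (north_steps R)"
    unfolding partial_transversal_def using bij_betw_the_inv_into[OF bij] by blast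
  then show "north_steps R \<in> indep (lattice_path_matroid m r P Q)"
    by (auto simp: indep_lattice_path_matroid north_steps_def len)
qed

text \<open>The parts of \<open>C\<close> up to \<open>k\<close> and beyond \<open>k\<close> are
  proper subsets of a circuit, hence independent. Their matchings can only use indices up to
  \<open>height Q k\<close> and above it, respectively, so they glue to a matching of all of
  \<open>C\<close>, which is impossible.\<close>

lemma no_circuit_across_meeting_point:
  assumes "height P k = height Q k"
    and "circuit (lattice_path_matroid m r P Q) C" and "x \<in> C" and "x \<le> k"
    and "y \<in> C" and "k < y"
  shows False
proof -
  let ?A = "north_sets m r P Q" and ?h = "height Q k"
  have C: "C \<subseteq> {1..m + r}" "\<not> partial_transversal {1..r} ?A C"
    and sub: "\<And>D. D \<subset> C \<Longrightarrow> partial_transversal {1..r} ?A D"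
    using assms(2) unfolding circuit_def indep_lattice_path_matroid by auto
  have split: "j \<le> k \<longleftrightarrow> i \<le> ?h" if j: "j \<in> ?A i" for i j
  proof -
    obtain R where R: "R \<in> paths_between m r P Q" and ith: "ith_north_step R i j"
      using j unfolding north_sets_def by blast
    \<comment> \<open>\<open>R\<close> is squeezed between \<open>P\<close> and \<open>Q\<close>,
      which agree at \<open>k\<close>.\<close>
    have "height R k = ?h"
      using R assms(1) unfolding paths_between_def never_above_def
      by (metis (mono_tags, lifting) mem_Collect_eq nle_le)
    \<comment> \<open>Heights are monotone, and a North step after \<open>k\<close> ends strictly
      higher than \<open>height R k\<close>.\<close>
    then show ?thesis
      using ith height_mono[of j k R] height_less_North[of k j R]
      by (cases "k < j") (auto simp: ith_north_step_def)
  qed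
  \<comment> \<open>The first part misses \<open>y\<close>, the second misses
    \<open>x\<close>.\<close>
  have "C \<inter> {..k} \<noteq> C" and "C \<inter> {k<..} \<noteq> C"
    using assms(3-6) by (auto simp: set_eq_iff not_le[symmetric])
  then have "C \<inter> {..k} \<subset> C" and "C \<inter> {k<..} \<subset> C" by blast+
  note parts = this[THEN sub]
  from parts(1) have "partial_transversal ({1..r} \<inter> {..?h}) ?A (C \<inter> {..k})"
    by (rule partial_transversal_restrict_index) (use split in auto)
  moreover from parts(2) have "partial_transversal ({1..r} \<inter> {?h<..}) ?A (C \<inter> {k<..})"
    by (rule partial_transversal_restrict_index) (use split in fastforce)
  ultimately have "partial_transversal ({1..r} \<inter> {..?h} \<union> {1..r} \<inter> {?h<..}) ?A
      (C \<inter> {..k} \<union> C \<inter> {k<..})"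
    by (rule partial_transversal_Un) auto
  moreover have "{1..r} \<inter> {..?h} \<union> {1..r} \<inter> {?h<..} = {1..r}"
    and "C \<inter> {..k} \<union> C \<inter> {k<..} = C" by auto
  ultimately show False using C by simp
qed

lemma connected_imp_height_less:
  assumes "never_above P Q" and "connected_matroid (lattice_path_matroid m r P Q)"
    and "0 < k" and "k < m + r"
  shows "height P k < height Q k"
proof (rule ccontr)
  assume "\<not> height P k < height Q k"
  then have eq: "height P k = height Q k"
    using assms(1) by (simp add: never_above_def le_antisym not_less)
  have "k \<in> {1..m + r}" "Suc k \<in> {1..m + r}" "k \<noteq> Suc k"
    using assms(3,4) by auto
  then obtain C where "circuit (lattice_path_matroid m r P Q) C" "k \<in> C" "Suc k \<in> C"
    using assms(2) unfolding connected_matroid_def ground_lattice_path_matroid by meson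
  then show False
    using no_circuit_across_meeting_point[OF eq] by blast
qed

section \<open>The spanning circuit\<close>

lemma spanning_circuit_north_steps:
  assumes P: "P \<in> lattice_paths m r" and Q: "Q \<in> lattice_paths m r"
    and PQ: "never_above P Q" and n: "m + r \<ge> 2"
    and less: "\<And>k. 0 < k \<Longrightarrow> k < m + r \<Longrightarrow> height P k < height Q k"
  shows "spanning_circuit (lattice_path_matroid m r P Q) (insert (m + r) (north_steps Q))"
proof -
  let ?M = "lattice_path_matroid m r P Q"
  \<comment> \<open>\<open>l\<close> is the list position of the last step, whose number is
    \<open>Suc l\<close>.\<close>
  define l where "l = m + r - 1"
  have l: "m + r = Suc l" "0 < l" using n by (auto simp: l_def)
  have len: "length P = Suc l" "length Q = Suc l"
    using P Q l by (auto simp: lattice_paths_iff)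
  have end_heights: "height P (Suc l) = r" "height Q (Suc l) = r"
    using P Q l by (auto simp: lattice_paths_iff)
  \<comment> \<open>\<open>P\<close> has height at least \<open>r - 1\<close> before its last step,
    so \<open>Q\<close> has already reached \<open>r\<close> there and must end with
    \<open>East\<close>.\<close>
  have "height P l < height Q l"
    using less l by simp
  moreover have "r \<le> height P l + 1"
    using end_heights(1) by (simp add: height_Suc split: if_splits)
  ultimately have last_East: "Q ! l = East"
    using end_heights(2) len by (cases "Q ! l") (auto simp: height_Suc)
  have Q_between: "Q \<in> paths_between m r P Q"
    using Q PQ by (simp add: paths_between_def never_above_def)
  note Q_indep = indep_north_steps[OF Q_between]
  let ?C = "insert (Suc l) (north_steps Q)"
  have fin: "finite (north_steps Q)" and new: "Suc l \<notin> north_steps Q"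
    using last_East by (auto simp: north_steps_def)
  have card_le: "card X \<le> r" if "X \<in> indep ?M" for X
    using partial_transversal_card_le[of "{1..r}" "north_sets m r P Q" X] that
    unfolding indep_lattice_path_matroid by simp
  have C_ground: "?C \<subseteq> {1..m + r}"
    using l len by (auto simp: north_steps_def)
  have "card ?C = Suc r"
    using fin new Q_indep(2) by simp
  \<comment> \<open>No independent set exceeds the \<open>r\<close> sets of the presentation in
    size.\<close>
  then have C_dep: "?C \<notin> indep ?M"
    using card_le by fastforce
  have remove: "?C - {x} \<in> indep ?M" if "x \<in> ?C" for x
  proof (cases "x = Suc l")
    case True
    then show ?thesis using Q_indep(1) new by simp
  next
    case False
    then have "x \<in> north_steps Q" using that by simp
    then obtain p where x: "x = Suc p" and p: "p < length Q" "Q ! p = North"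
      by (cases x) (auto simp: north_steps_def)
    have pl: "p < l" using p False x len by simp
    \<comment> \<open>The North step numbered \<open>x\<close> is traded for one at the end, so that
      the North steps of \<open>R\<close> are exactly \<open>?C - {x}\<close>.\<close>
    define R where "R = Q[p := East, l := North]"
    have height_R: "height R j + (if p < j then 1 else 0) = height Q j + (if l < j then 1 else 0)" for j
      using height_update_North[of l "Q[p := East]" j] height_update_East[OF p, of j]
        pl last_East len by (simp add: R_def)
    have le: "height R j \<le> height Q j" for j
      using height_R[of j] pl by (auto split: if_splits)
    have ge: "height P j \<le> height R j" for j
    \<comment> \<open>In this range \<open>R\<close> is one lower than \<open>Q\<close>, and the
      strict gap between \<open>P\<close> and \<open>Q\<close> absorbs the loss; elsewhere
      \<open>R\<close> and \<open>Q\<close> have equal heights.\<close>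
    proof (cases "p < j \<and> j \<le> l")
      case True
      then show ?thesis using height_R[of j] less[of j] l by simp
    next
      case False
      then show ?thesis
        using height_R[of j] PQ pl by (auto simp: never_above_def split: if_splits)
    qed
    have "R \<in> paths_between m r P Q"
      using le ge height_R[of "Suc l"] pl end_heights len l
      by (simp add: paths_between_def never_above_def lattice_paths_iff) (simp add: R_def)
    moreover have "north_steps R = ?C - {x}"
    proof (rule set_eqI)
      fix j
      show "j \<in> north_steps R \<longleftrightarrow> j \<in> ?C - {x}"
        using x pl len
        by (cases j) (auto simp: north_steps_def R_def nth_list_update)
    qed
    ultimately show ?thesis using indep_north_steps(1) by metis
  qed
  have "circuit ?M ?C"
    unfolding circuit_def
  proof (intro conjI allI impI)
    fix D assume "D \<subset> ?C"
    then obtain x where "x \<in> ?C" "D \<subseteq> ?C - {x}" by blast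
    then show "D \<in> indep ?M"
      using remove[of x] partial_transversal_subset[of _ _ "?C - {x}" D]
      unfolding indep_lattice_path_matroid by (meson subset_trans)
  qed (use C_ground C_dep in simp_all)
  \<comment> \<open>Such an \<open>X\<close> contains the independent set
    \<open>north_steps Q\<close> of maximal size \<open>r\<close>. Hence adding any element to
    \<open>?C\<close> keeps the rank.\<close>
  moreover have "mrank ?M X = r" if "?C \<subseteq> X" for X
    by (rule mrank_eqI[OF Q_indep(1) _ Q_indep(2) card_le]) (use that in auto)
  then have "mrank ?M (insert x ?C) = mrank ?M ?C" for x
    by (metis order_refl subset_insertI)
  then have "mclosure ?M ?C = ground ?M"
    unfolding mclosure_def by blast
  ultimately show ?thesis
    unfolding spanning_circuit_def l(1) by simp
qed

theorem theorem3p3: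
  fixes m r :: nat and P Q :: "step list"
  assumes "P \<in> lattice_paths m r" and "Q \<in> lattice_paths m r"
    and "never_above P Q"
    and "connected_matroid (lattice_path_matroid m r P Q)"
    and "card (ground (lattice_path_matroid m r P Q)) \<ge> 2"
  shows "\<exists>C. spanning_circuit (lattice_path_matroid m r P Q) C"
  \<comment> \<open>The ground set is \<open>{1..m + r}\<close>, so the bound on its cardinality
    says \<open>m + r \<ge> 2\<close>.\<close>
  using spanning_circuit_north_steps[OF assms(1-3)] connected_imp_height_less[OF assms(3,4)]
    assms(5) by auto

end
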